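(* Let $T\colon[0,1]\to[0,1]$ be measurable and let $\mu$ be a $T$-invariant Borel probability measure on $[0,1]$ such that $([0,1],T,\mu)$ is exponentially mixing for bounded variation against $L^1$. Suppose that $y\in\operatorname{supp}\mu$ is a point for which there are constants $c_1,r_0>0$ such that $$B(y,r)\cap T^kB(y,r)=\emptyset$$ for all integers $1\le k\le -c_1\log r$ and all $0<r<r_0$. Then $$\lim_{r\to0}\mu\{\,x:\tau_{B(y,r)}(x)>t/\mu(B(y,r))\,\}=e^{-t}$$ for all $t\ge0$.
   Context: $B(y,r)$ denotes the ball in $[0,1]$ with centre $y$ and radius $r$. For a measurable set $A\subset[0,1]$, the first hitting time of $x$ to $A$ is $\tau_A(x)=\min\{\,n\ge1:T^n(x)\in A\,\}$ (with value $\infty$ if there is no such $n$). The system $([0,1],T,\mu)$ is exponentially mixing for bounded variation against $L^1$ if there are constants $\tau,\tilde C>0$ such that $$\Bigl|\int f\circ T^n\, g\,\mathrm d\mu-\int f\,\mathrm d\mu\int g\,\mathrm d\mu\Bigr|\le\tilde C e^{-\tau n}\lVert f\rVert_{L^1}\lVert g\rVert_{BV}$$ for all $n$ and all functions $f,g$ with $\lVert f\rVert_{L^1}<\infty$ (the $L^1(\mu)$ norm) and $\lVert g\rVert_{BV}<\infty$ (the usual bounded variation norm on $[0,1]$, e.g. supremum norm plus total variation). *)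

theory Defs
  imports "HOL-Probability.Probability"
begin

abbreviation unit_borel :: "real measure" where
  "unit_borel \<equiv> restrict_space borel {0..1}"

definition unit_ball :: "real \<Rightarrow> real \<Rightarrow> real set" where
  "unit_ball y r = ball y r \<inter> {0..1}"

definition measure_support :: "'a::topological_space measure \<Rightarrow> 'a set" where
  "measure_support M =
     {y \<in> space M. \<forall>U. open U \<longrightarrow> y \<in> U \<longrightarrow> emeasure M (U \<inter> space M) > 0}"

text \<open>The infimum of the empty set is \<open>\<infinity>\<close>, so a point that never enters \<open>A\<close> has hitting
  time \<open>\<infinity>\<close>; otherwise the infimum is attained.\<close>

definition hitting_time :: "('a \<Rightarrow> 'a) \<Rightarrow> 'a set \<Rightarrow> 'a \<Rightarrow> enat" where
  "hitting_time T A x = (INF n \<in> {n. 1 \<le> n \<and> (T ^^ n) x \<in> A}. enat n)"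

text \<open>The points \<open>p 0 \<le> \<dots> \<le> p n\<close> need not be distinct or include the end points, which does not
  change the supremum. It is the pointwise variation, not the variation of an equivalence class
  modulo null sets.\<close>

definition total_variation :: "real \<Rightarrow> real \<Rightarrow> (real \<Rightarrow> real) \<Rightarrow> ennreal" where
  "total_variation a b g =
     (SUP (n, p) \<in> {(n::nat, p::nat \<Rightarrow> real). mono_on {..n} p \<and> p ` {..n} \<subseteq> {a..b}}.
        ennreal (\<Sum>i<n. \<bar>g (p (Suc i)) - g (p i)\<bar>))"

definition bv_norm :: "(real \<Rightarrow> real) \<Rightarrow> ennreal" where
  "bv_norm g = (SUP x\<in>{0..1}. ennreal \<bar>g x\<bar>) + total_variation 0 1 g"

text \<open>A function with finite \<open>bv_norm\<close> is bounded and Borel measurable on the unit interval, so for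
  a finite Borel measure \<open>M\<close> there and \<open>M\<close>-preserving \<open>T\<close> every integrand below is integrable.\<close>

definition exponentially_mixing_BV_L1 :: "real measure \<Rightarrow> (real \<Rightarrow> real) \<Rightarrow> bool" where
  "exponentially_mixing_BV_L1 M T \<longleftrightarrow>
     (\<exists>\<theta> C. \<theta> > 0 \<and> C > 0 \<and>
       (\<forall>n f g. integrable M f \<longrightarrow> bv_norm g < \<infinity> \<longrightarrow>
          \<bar>(\<integral>x. f ((T ^^ n) x) * g x \<partial>M) - (\<integral>x. f x \<partial>M) * (\<integral>x. g x \<partial>M)\<bar>
            \<le> C * exp (- \<theta> * real n) * (\<integral>x. \<bar>f x\<bar> \<partial>M) * enn2real (bv_norm g)))"

end

theory Submission
  imports Defs "HOL-Real_Asymp.Real_Asymp"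
begin

text \<open>Write \<open>B\<close> for the ball, \<open>m = \<mu>(B)\<close> and \<open>G(n) = \<mu>(\<tau>\<^sub>B > n)\<close>. By invariance
  \<open>G(n+1) = G(n) - \<mu>(B \<inter> {\<tau>\<^sub>B > n})\<close>, so if \<open>|\<mu>(B \<inter> {\<tau>\<^sub>B > n}) - m G(n)| \<le> \<delta> m\<close> for all \<open>n\<close>,
  then \<open>|G(n) - (1 - m)^n| \<le> \<delta>\<close>. To bound \<open>\<delta>\<close>, replace \<open>{\<tau>\<^sub>B > n}\<close> by \<open>T\<^sup>-\<^sup>p{\<tau>\<^sub>B > n - p}\<close> with a gap
  \<open>p\<close> of order \<open>log(1/m)\<close>, decorrelate this from \<open>B\<close> by mixing, and
  bound the cost of the gap by \<open>\<Sum>\<^sub>k\<^sub>\<le>\<^sub>p \<mu>(B \<inter> T\<^sup>-\<^sup>kB)\<close>. The terms with small \<open>k\<close> vanish by hypothesis,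
  and the others are controlled by mixing again. The absence of short returns also makes
  \<open>B, T\<^sup>-\<^sup>1B, \<dots>, T\<^sup>-\<^sup>KB\<close> disjoint, which forces \<open>m \<rightarrow> 0\<close>.\<close>

section \<open>Hitting times and survival sets\<close>

text \<open>The event that the hitting time exceeds \<open>n\<close>, phrased through finitely many
  iterates so that its measurability is immediate. Time 0 is not tested, so \<open>n = 0\<close>
  gives the whole space.\<close>

definition survival_set :: "'a measure \<Rightarrow> ('a \<Rightarrow> 'a) \<Rightarrow> 'a set \<Rightarrow> nat \<Rightarrow> 'a set" where
  "survival_set M T A n = {x \<in> space M. \<forall>k\<in>{1..n}. (T ^^ k) x \<notin> A}"

text \<open>A hitting time is an integer or infinite, so it exceeds \<open>s\<close> exactly when it
  exceeds the integer part of \<open>s\<close>. This turns the real threshold of the theorem into a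
  survival set.\<close>

lemma hitting_time_gt_iff:
  assumes "s \<ge> 0"
  shows "ereal_of_enat (hitting_time T A x) > ereal s \<longleftrightarrow> (\<forall>k\<in>{1..nat \<lfloor>s\<rfloor>}. (T ^^ k) x \<notin> A)"
proof
  assume gt: "ereal_of_enat (hitting_time T A x) > ereal s"
  show "\<forall>k\<in>{1..nat \<lfloor>s\<rfloor>}. (T ^^ k) x \<notin> A"
  proof (intro ballI notI)
    fix k assume k: "k \<in> {1..nat \<lfloor>s\<rfloor>}" and "(T ^^ k) x \<in> A"
    then have "hitting_time T A x \<le> enat k"
      unfolding hitting_time_def by (intro INF_lower) auto
    then have "ereal_of_enat (hitting_time T A x) \<le> ereal_of_enat (enat k)"
      by (simp only: ereal_of_enat_le_iff)
    also have "\<dots> \<le> ereal s"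
      using k assms by (simp add: le_nat_floor) linarith
    finally show False using gt by simp
  qed
next
  assume none: "\<forall>k\<in>{1..nat \<lfloor>s\<rfloor>}. (T ^^ k) x \<notin> A"
  have "hitting_time T A x \<ge> enat (Suc (nat \<lfloor>s\<rfloor>))"
    unfolding hitting_time_def
  proof (rule INF_greatest)
    fix k assume "k \<in> {n. 1 \<le> n \<and> (T ^^ n) x \<in> A}"
    then have "k > nat \<lfloor>s\<rfloor>"
      using none by (metis (no_types, lifting) atLeastAtMost_iff linorder_not_less mem_Collect_eq)
    then show "enat (Suc (nat \<lfloor>s\<rfloor>)) \<le> enat k" by simp
  qed
  then have "ereal_of_enat (enat (Suc (nat \<lfloor>s\<rfloor>))) \<le> ereal_of_enat (hitting_time T A x)"
    by (simp only: ereal_of_enat_le_iff)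
  moreover have "ereal s < ereal_of_enat (enat (Suc (nat \<lfloor>s\<rfloor>)))"
    using assms by simp linarith
  ultimately show "ereal_of_enat (hitting_time T A x) > ereal s"
    by (rule less_le_trans[rotated])
qed

section \<open>Invariance and the measure of survival sets\<close>

locale measure_preserving = prob_space M for M :: "'a measure" +
  fixes T :: "'a \<Rightarrow> 'a"
  assumes T_measurable [measurable]: "T \<in> measurable M M"
    and T_invariant: "distr M M T = M"
begin

lemma funpow_measurable [measurable]: "(T ^^ n) \<in> measurable M M"
  by (induction n) simp_all

lemma funpow_in_space: "x \<in> space M \<Longrightarrow> (T ^^ n) x \<in> space M"
  using measurable_space[OF funpow_measurable] by blast

lemma prob_vimage:
  assumes "A \<in> sets M"
  shows "prob (T -` A \<inter> space M) = prob A"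
  using measure_distr[OF T_measurable assms] T_invariant by simp

lemma prob_funpow_vimage:
  assumes "A \<in> sets M"
  shows "prob ((T ^^ n) -` A \<inter> space M) = prob A"
proof (induction n)
  case 0
  then show ?case using sets.sets_into_space[OF assms] by (simp add: Int_absorb2)
next
  case (Suc n)
  have "(T ^^ Suc n) -` A \<inter> space M = T -` ((T ^^ n) -` A \<inter> space M) \<inter> space M"
    using measurable_space[OF T_measurable] by (auto simp: funpow_swap1)
  then show ?case using Suc prob_vimage[OF measurable_sets[OF funpow_measurable assms]]
    by (simp del: funpow.simps)
qed

abbreviation survival :: "'a set \<Rightarrow> nat \<Rightarrow> 'a set" where
  "survival \<equiv> survival_set M T"

lemma survival_measurable [measurable]:
  assumes [measurable]: "A \<in> sets M"
  shows "survival A n \<in> sets M"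
  unfolding survival_set_def by measurable

text \<open>Time is shifted by one: the condition on \<open>x\<close> at time 1 becomes a condition
  on \<open>T x\<close> at time 0. Survival sets do not test time 0, hence the explicit removal of
  \<open>A\<close>.\<close>

lemma survival_Suc: "survival A (Suc n) = T -` (survival A n - A) \<inter> space M"
proof -
  have "{1..Suc n} = insert 1 (Suc ` {1..n})"
    by (auto simp: image_Suc_atLeastAtMost)
  then have "(\<forall>k\<in>{1..Suc n}. (T ^^ k) x \<notin> A) \<longleftrightarrow> T x \<notin> A \<and> (\<forall>k\<in>{1..n}. (T ^^ k) (T x) \<notin> A)" for x
    by (simp add: funpow_swap1 del: image_Suc_atLeastAtMost)
  then show ?thesis
    using measurable_space[OF T_measurable] by (auto simp: survival_set_def)
qed

lemma prob_survival_Suc: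
  assumes [measurable]: "A \<in> sets M"
  shows "prob (survival A (Suc n)) = prob (survival A n) - prob (A \<inter> survival A n)"
proof -
  have "prob (survival A (Suc n)) = prob (survival A n - A)"
    unfolding survival_Suc by (rule prob_vimage) measurable
  also have "\<dots> = prob (survival A n) - prob (A \<inter> survival A n)"
    by (subst finite_measure_Diff') (auto simp: Int_commute)
  finally show ?thesis .
qed

text \<open>A point common to the preimages of \<open>A\<close> under two different iterates up to
  \<open>K\<close> would yield a return to \<open>A\<close> within \<open>K\<close> steps. So the
  \<open>Suc K\<close> preimages, time 0 included, are disjoint, have equal measure and fit into
  total mass 1.\<close>

lemma prob_le_of_no_return:
  assumes [measurable]: "A \<in> sets M"
    and no_return: "\<And>k. 1 \<le> k \<Longrightarrow> k \<le> K \<Longrightarrow> A \<inter> (T ^^ k) -` A = {}"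
  shows "real (Suc K) * prob A \<le> 1"
proof -
  let ?V = "\<lambda>k. (T ^^ k) -` A \<inter> space M"
  have disj: "?V i \<inter> ?V j = {}" if "i < j" "j \<le> K" for i j
  proof (rule ccontr)
    assume "?V i \<inter> ?V j \<noteq> {}"
    then obtain x where x: "(T ^^ i) x \<in> A" "(T ^^ j) x \<in> A" by auto
    have "(T ^^ j) x = (T ^^ (j - i)) ((T ^^ i) x)"
      using that by (metis comp_apply funpow_add le_add_diff_inverse2 less_imp_le)
    then have "(T ^^ i) x \<in> A \<inter> (T ^^ (j - i)) -` A" using x by simp
    moreover have "A \<inter> (T ^^ (j - i)) -` A = {}" using that by (intro no_return) auto
    ultimately show False by blast
  qed
  have "disjoint_family_on ?V {..K}"
    unfolding disjoint_family_on_def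
  proof (intro ballI impI)
    fix i j assume "i \<in> {..K}" "j \<in> {..K}" "i \<noteq> j"
    then show "?V i \<inter> ?V j = {}"
      using disj[of i j] disj[of j i] by (cases "i < j") (auto simp: Int_commute)
  qed
  then have "prob (\<Union>k\<in>{..K}. ?V k) = (\<Sum>k\<in>{..K}. prob (?V k))"
    by (intro finite_measure_finite_Union) auto
  also have "\<dots> = real (Suc K) * prob A"
    by (simp add: prob_funpow_vimage)
  finally show ?thesis using prob_le_1[of "\<Union>k\<in>{..K}. ?V k"] by linarith
qed

text \<open>Truncated subtraction makes the next lemmas cover \<open>n < p\<close> as well.\<close>

lemma survival_subset_vimage: "survival A n \<subseteq> (T ^^ p) -` survival A (n - p) \<inter> space M"
proof
  fix x assume x: "x \<in> survival A n"
  have "(T ^^ k) ((T ^^ p) x) \<notin> A" if "k \<in> {1..n - p}" for k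
  proof -
    have "(T ^^ (k + p)) x \<notin> A" using x that by (auto simp: survival_set_def)
    then show ?thesis by (simp add: funpow_add)
  qed
  then show "x \<in> (T ^^ p) -` survival A (n - p) \<inter> space M"
    using x funpow_in_space by (auto simp: survival_set_def)
qed

lemma vimage_survival_diff:
  "((T ^^ p) -` survival A (n - p) \<inter> space M) - survival A n
    \<subseteq> (\<Union>k\<in>{1..p}. (T ^^ k) -` A \<inter> space M)"
proof
  fix x assume x: "x \<in> ((T ^^ p) -` survival A (n - p) \<inter> space M) - survival A n"
  then obtain k where k: "k \<in> {1..n}" "(T ^^ k) x \<in> A"
    by (auto simp: survival_set_def)
  \<comment> \<open>A visit at a time \<open>k > p\<close> would be a visit of
    \<open>(T ^^ p) x\<close> at time \<open>k - p\<close>, which its survival up to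
    \<open>n - p\<close> forbids.\<close>
  have "k \<le> p"
  proof (rule ccontr)
    assume "\<not> k \<le> p"
    then have "k - p \<in> {1..n - p}" and "(T ^^ k) x = (T ^^ (k - p)) ((T ^^ p) x)"
      using k by (auto simp flip: funpow_add[unfolded comp_def, THEN fun_cong])
    then show False using x k by (auto simp: survival_set_def)
  qed
  then show "x \<in> (\<Union>k\<in>{1..p}. (T ^^ k) -` A \<inter> space M)" using k x by auto
qed

lemma prob_survival_diff:
  assumes [measurable]: "A \<in> sets M"
  shows "prob (survival A (n - p)) - prob (survival A n) \<le> real p * prob A"
proof -
  let ?W = "(T ^^ p) -` survival A (n - p) \<inter> space M"
  \<comment> \<open>By invariance \<open>?W\<close> has the measure of
    \<open>survival A (n - p)\<close>. Since it contains \<open>survival A n\<close>, the difference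
    becomes the measure of a single set, open to a union bound.\<close>
  have "prob (survival A (n - p)) - prob (survival A n) = prob ?W - prob (survival A n)"
    by (subst prob_funpow_vimage) auto
  also have "\<dots> = prob (?W - survival A n)"
    using survival_subset_vimage by (intro finite_measure_Diff[symmetric]) auto
  also have "\<dots> \<le> prob (\<Union>k\<in>{1..p}. (T ^^ k) -` A \<inter> space M)"
    by (intro finite_measure_mono vimage_survival_diff) auto
  also have "\<dots> \<le> (\<Sum>k\<in>{1..p}. prob ((T ^^ k) -` A \<inter> space M))"
    by (intro finite_measure_subadditive_finite) auto
  also have "\<dots> = real p * prob A" by (simp add: prob_funpow_vimage)
  finally show ?thesis .
qed

section \<open>Geometric decay of survival probabilities\<close>

text \<open>One \<open>real p * prob A\<close> is the main term of the returns to \<open>A\<close>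
  within the gap, the other the change of the survival probability when the gap is dropped. The
  second summand collects the mixing errors of the returns after time \<open>K\<close>, the third is
  the decorrelation error across the gap. The gap \<open>p\<close> stays free, and the bound is
  uniform in \<open>n\<close>.\<close>

lemma prob_survival_approx:
  assumes A [measurable]: "A \<in> sets M" and "prob A > 0" and "\<theta> > 0" and "D \<ge> 0"
    and mixing: "\<And>n E. E \<in> sets M \<Longrightarrow>
      \<bar>prob (A \<inter> ((T ^^ n) -` E \<inter> space M)) - prob E * prob A\<bar> \<le> D * exp (- \<theta> * real n) * prob E"
    and no_return: "\<And>k. 1 \<le> k \<Longrightarrow> k \<le> K \<Longrightarrow> A \<inter> (T ^^ k) -` A = {}"
  shows "\<bar>prob (survival A n) - (1 - prob A) ^ n\<bar>
    \<le> 2 * real p * prob A + D * exp (- \<theta> * real K) / (1 - exp (- \<theta>)) + D * exp (- \<theta> * real p) / prob A"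
    (is "_ \<le> ?\<delta>")
proof -
  define m where "m = prob A"
  define q where "q = exp (- \<theta>)"
  have m: "0 < m" "m \<le> 1" using assms by (auto simp: m_def)
  have q: "0 < q" "q < 1" using assms by (auto simp: q_def)
  have exp_q: "exp (- \<theta> * real k) = q ^ k" for k
    by (simp add: q_def mult.commute flip: exp_of_nat_mult)
  define Q where "Q = q ^ K / (1 - q)"
  have return_bound: "prob (A \<inter> ((T ^^ k) -` A \<inter> space M)) \<le> m * m + (if k \<le> K then 0 else D * q ^ k * m)"
    if "k \<in> {1..p}" for k
  proof (cases "k \<le> K")
    case True
    then have "A \<inter> ((T ^^ k) -` A \<inter> space M) = {}" using no_return that by auto
    then show ?thesis using True by simp
  next
    case False
    \<comment> \<open>Mixing is applied with \<open>E = A\<close>, so its factor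
      \<open>prob E\<close> supplies the factor \<open>m\<close> in the error.\<close>
    then show ?thesis using mixing[of A k] by (simp add: exp_q[simplified] m_def)
  qed
  have returns: "(\<Sum>k\<in>{1..p}. prob (A \<inter> ((T ^^ k) -` A \<inter> space M))) \<le> m * (real p * m + D * Q)"
  proof -
    \<comment> \<open>The range is enlarged to the \<open>Suc p\<close> exponents from
      \<open>K\<close> on. This gives a shifted geometric sum, bounded by \<open>Q\<close>
      independently of \<open>p\<close>.\<close>
    have "(\<Sum>k\<in>{1..p}. if k \<le> K then 0 else q ^ k) \<le> (\<Sum>k\<in>{K..<K + Suc p}. q ^ k)"
    proof -
      have "(\<Sum>k\<in>{1..p}. if k \<le> K then 0 else q ^ k) = (\<Sum>k\<in>{k\<in>{1..p}. K < k}. q ^ k)"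
        by (auto simp: sum.If_cases intro!: sum.cong)
      also have "\<dots> \<le> (\<Sum>k\<in>{K..<K + Suc p}. q ^ k)"
        using q by (intro sum_mono2) auto
      finally show ?thesis .
    qed
    also have "\<dots> = q ^ K * (\<Sum>k<Suc p. q ^ k)"
      unfolding sum_distrib_left
      by (rule sum.reindex_bij_witness[of _ "\<lambda>i. i + K" "\<lambda>i. i - K"]) (auto simp flip: power_add)
    also have "\<dots> \<le> q ^ K * (1 / (1 - q))"
    proof (rule mult_left_mono)
      have "(\<Sum>k<Suc p. q ^ k) = (1 - q ^ Suc p) / (1 - q)"
        using q sum_gp_strict[of q "Suc p"] by (simp del: sum.lessThan_Suc)
      also have "\<dots> \<le> 1 / (1 - q)" using q by (intro divide_right_mono) auto
      finally show "(\<Sum>k<Suc p. q ^ k) \<le> 1 / (1 - q)" .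
    qed (use q in auto)
    finally have tail: "(\<Sum>k\<in>{1..p}. if k \<le> K then 0 else q ^ k) \<le> Q" by (simp add: Q_def)
    have "(\<Sum>k\<in>{1..p}. prob (A \<inter> ((T ^^ k) -` A \<inter> space M)))
        \<le> (\<Sum>k\<in>{1..p}. m * m + D * m * (if k \<le> K then 0 else q ^ k))"
      using return_bound by (intro sum_mono) (force simp: mult_ac)
    also have "\<dots> = real p * m * m + D * m * (\<Sum>k\<in>{1..p}. if k \<le> K then 0 else q ^ k)"
      by (simp only: sum.distrib sum_distrib_left) simp
    also have "\<dots> \<le> real p * m * m + D * m * Q"
      using tail m assms by (intro add_left_mono mult_left_mono) auto
    finally show ?thesis by (simp add: algebra_simps)
  qed
  have \<delta>: "?\<delta> = 2 * real p * m + D * Q + D * q ^ p / m"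
    unfolding exp_q Q_def m_def q_def by simp
  \<comment> \<open>Three comparisons: \<open>survival A j\<close> inside \<open>A\<close> with
    \<open>?W\<close> (returns within the gap), \<open>?W\<close> inside \<open>A\<close> with the
    product \<open>m * prob ?E\<close> (mixing), and \<open>prob ?E\<close> with
    \<open>prob (survival A j)\<close> (dropped times).\<close>
  have almost_indep: "\<bar>prob (A \<inter> survival A j) - m * prob (survival A j)\<bar> \<le> m * ?\<delta>" for j
  proof -
    let ?W = "(T ^^ p) -` survival A (j - p) \<inter> space M"
    let ?E = "survival A (j - p)"
    have "prob (A \<inter> ?W) - prob (A \<inter> survival A j) = prob ((A \<inter> ?W) - (A \<inter> survival A j))"
      using survival_subset_vimage[of A j p] by (intro finite_measure_Diff[symmetric]) auto
    also have "\<dots> \<le> prob (\<Union>k\<in>{1..p}. A \<inter> ((T ^^ k) -` A \<inter> space M))"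
      using vimage_survival_diff[of p A j] by (intro finite_measure_mono) (blast, measurable)
    also have "\<dots> \<le> (\<Sum>k\<in>{1..p}. prob (A \<inter> ((T ^^ k) -` A \<inter> space M)))"
      by (intro finite_measure_subadditive_finite) auto
    finally have gap: "prob (A \<inter> ?W) - prob (A \<inter> survival A j) \<le> m * (real p * m + D * Q)"
      using returns by linarith
    have gap': "prob (A \<inter> survival A j) \<le> prob (A \<inter> ?W)"
      using survival_subset_vimage[of A j p] by (intro finite_measure_mono) (blast, measurable)
    have "\<bar>prob (A \<inter> ?W) - prob ?E * m\<bar> \<le> D * q ^ p * prob ?E"
      using mixing[of ?E p] unfolding exp_q m_def by simp
    \<comment> \<open>Here \<open>prob ?E\<close> is bounded by 1 and not by a multiple of
      \<open>m\<close>, which is why this error is divided by \<open>m\<close> in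
      \<open>?\<delta>\<close>.\<close>
    also have "\<dots> \<le> D * q ^ p * 1"
      using assms q by (intro mult_left_mono) auto
    finally have decor: "\<bar>prob (A \<inter> ?W) - m * prob ?E\<bar> \<le> D * q ^ p" by (simp add: mult.commute)
    have "m * (prob ?E - prob (survival A j)) \<le> m * (real p * m)"
      using prob_survival_diff[OF A, of j p] m by (intro mult_left_mono) (auto simp: m_def)
    then have shift: "m * prob ?E - m * prob (survival A j) \<le> m * (real p * m)"
      by (simp add: right_diff_distrib)
    have "prob (survival A j) \<le> prob ?E"
      by (intro finite_measure_mono) (auto simp: survival_set_def)
    then have shift': "m * prob (survival A j) \<le> m * prob ?E"
      using m by (intro mult_left_mono) auto
    have nonneg: "0 \<le> m * (real p * m)" "0 \<le> m * (D * Q)"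
      using m q assms by (auto simp: Q_def)
    have "m * ?\<delta> = m * (real p * m) + m * (real p * m + D * Q) + D * q ^ p"
      unfolding \<delta> using m by (simp add: field_simps)
    then show ?thesis using gap gap' decor shift shift' nonneg
      by (simp only: distrib_left abs_le_iff) linarith
  qed
  have \<delta>_nonneg: "?\<delta> \<ge> 0" unfolding \<delta> Q_def using m q assms by auto
  show ?thesis
  proof (induction n)
    case 0
    then show ?case using \<delta>_nonneg by (simp add: survival_set_def prob_space)
  next
    case (Suc n)
    let ?G = "prob (survival A n)"
    \<comment> \<open>The new error is \<open>1 - m\<close> times the old one plus a contribution of
      at most \<open>m * ?\<delta>\<close>. This convex combination reproduces
      \<open>?\<delta>\<close>, so errors do not accumulate with \<open>n\<close>.\<close>
    have "prob (survival A (Suc n)) - (1 - m) ^ Suc n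
        = (1 - m) * (?G - (1 - m) ^ n) - (prob (A \<inter> survival A n) - m * ?G)"
      by (simp add: prob_survival_Suc algebra_simps)
    also have "\<bar>\<dots>\<bar> \<le> \<bar>(1 - m) * (?G - (1 - m) ^ n)\<bar> + \<bar>prob (A \<inter> survival A n) - m * ?G\<bar>"
      by (rule abs_triangle_ineq4)
    also have "\<dots> \<le> (1 - m) * ?\<delta> + m * ?\<delta>"
    proof (rule add_mono[OF _ almost_indep])
      show "\<bar>(1 - m) * (?G - (1 - m) ^ n)\<bar> \<le> (1 - m) * ?\<delta>"
        using Suc m unfolding abs_mult by (intro mult_mono) (auto simp: m_def)
    qed
    also have "\<dots> = ?\<delta>" by (simp only: left_diff_distrib) simp
    finally show ?case by (simp only: m_def)
  qed
qed

end

section \<open>Variation of ball indicators and the exponential limit\<close>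

text \<open>The supremum contributes 1 and each of the two possible jumps another 1. The bound does
  not depend on the ball, so mixing holds with one constant as the radius shrinks.\<close>

lemma bv_norm_indicator_unit_ball:
  assumes "r > 0"
  shows "bv_norm (indicator (unit_ball y r)) \<le> 3"
proof -
  let ?g = "indicator (unit_ball y r) :: real \<Rightarrow> real"
  have "(SUP x\<in>{0..1}. ennreal \<bar>?g x\<bar>) \<le> 1"
    by (intro SUP_least) (auto simp: indicator_def)
  moreover have "total_variation 0 1 ?g \<le> 2"
    unfolding total_variation_def
  proof (intro SUP_least, clarify)
    fix n :: nat and p :: "nat \<Rightarrow> real"
    assume p: "mono_on {..n} p" "p ` {..n} \<subseteq> {0..1}"
    \<comment> \<open>On the unit interval the indicator is \<open>u - v\<close> with
      \<open>u\<close> and \<open>v\<close> increasing, so the sum of their increments telescopes.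
      One inequality is strict and the other is not because the ball is open.\<close>
    define u where "u = (\<lambda>x. if y - r < x then 1 else 0 :: real)"
    define v where "v = (\<lambda>x. if y + r \<le> x then 1 else 0 :: real)"
    have "(\<Sum>i<n. \<bar>?g (p (Suc i)) - ?g (p i)\<bar>)
        \<le> (\<Sum>i<n. (u (p (Suc i)) - u (p i)) + (v (p (Suc i)) - v (p i)))"
    proof (rule sum_mono)
      fix i assume i: "i \<in> {..<n}"
      then have "p i \<le> p (Suc i)" by (auto intro!: mono_onD[OF p(1)])
      moreover have "p i \<in> p ` {..n}" "p (Suc i) \<in> p ` {..n}" using i by auto
      then have "p i \<in> {0..1}" "p (Suc i) \<in> {0..1}" using p(2) by blast+
      moreover have "?g x = u x - v x" if "x \<in> {0..1}" for x
        using that assms by (auto simp: u_def v_def indicator_def unit_ball_def dist_real_def)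
      ultimately show "\<bar>?g (p (Suc i)) - ?g (p i)\<bar>
          \<le> (u (p (Suc i)) - u (p i)) + (v (p (Suc i)) - v (p i))"
        by (auto simp: u_def v_def)
    qed
    also have "\<dots> = (u (p n) - u (p 0)) + (v (p n) - v (p 0))"
      by (simp add: sum.distrib sum_lessThan_telescope[of "\<lambda>i. u (p i)"]
          sum_lessThan_telescope[of "\<lambda>i. v (p i)"])
    also have "\<dots> \<le> 2" by (auto simp: u_def v_def)
    finally show "ennreal (\<Sum>i<n. \<bar>?g (p (Suc i)) - ?g (p i)\<bar>) \<le> 2"
      by (metis ennreal_leI ennreal_numeral)
  qed
  ultimately have "bv_norm ?g \<le> 1 + 2" unfolding bv_norm_def by (rule add_mono)
  then show ?thesis by simp
qed

text \<open>After taking logarithms, the exponent times \<open>m\<close> tends to \<open>t\<close>,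
  while \<open>ln (1 - m) / m\<close> tends to \<open>-1\<close>.\<close>

lemma power_floor_tendsto_exp:
  fixes t :: real
  assumes "t \<ge> 0"
  shows "((\<lambda>m. (1 - m) ^ nat \<lfloor>t / m\<rfloor>) \<longlongrightarrow> exp (- t)) (at_right 0)"
proof -
  have "((\<lambda>m. real_of_int \<lfloor>t / m\<rfloor> * m) \<longlongrightarrow> t) (at_right 0)"
  proof (rule tendsto_sandwich[of "\<lambda>m. t - m" _ _ "\<lambda>m. t"])
    show "\<forall>\<^sub>F m in at_right 0. t - m \<le> real_of_int \<lfloor>t / m\<rfloor> * m"
      using eventually_at_right_less[of 0]
    proof eventually_elim
      case (elim m)
      have "(t / m - 1) * m \<le> real_of_int \<lfloor>t / m\<rfloor> * m"
        using elim by (intro mult_right_mono) linarith+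
      then show ?case using elim by (simp add: left_diff_distrib)
    qed
    show "\<forall>\<^sub>F m in at_right 0. real_of_int \<lfloor>t / m\<rfloor> * m \<le> t"
      using eventually_at_right_less[of 0]
    proof eventually_elim
      case (elim m)
      have "real_of_int \<lfloor>t / m\<rfloor> * m \<le> t / m * m"
        using elim by (intro mult_right_mono) linarith+
      then show ?case using elim by simp
    qed
  qed (auto intro!: tendsto_eq_intros)
  moreover have "((\<lambda>m. ln (1 - m) / m) \<longlongrightarrow> (- 1 :: real)) (at_right 0)"
    by real_asymp
  ultimately have "((\<lambda>m. exp (real_of_int \<lfloor>t / m\<rfloor> * m * (ln (1 - m) / m))) \<longlongrightarrow> exp (t * - 1)) (at_right 0)"
    by (intro tendsto_exp tendsto_mult)
  moreover have "\<forall>\<^sub>F m in at_right 0.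
      exp (real_of_int \<lfloor>t / m\<rfloor> * m * (ln (1 - m) / m)) = (1 - m) ^ nat \<lfloor>t / m\<rfloor>"
    using eventually_at_right_real[of 0 1, simplified]
  proof eventually_elim
    case (elim m)
    then have "real_of_int \<lfloor>t / m\<rfloor> = real (nat \<lfloor>t / m\<rfloor>)" using assms by simp
    then show ?case using elim by (simp add: exp_of_nat_mult)
  qed
  ultimately show ?thesis by (simp add: tendsto_cong)
qed

section \<open>The exponential law for shrinking balls\<close>

theorem theorem3:
  fixes T :: "real \<Rightarrow> real" and \<mu> :: "real measure" and y c\<^sub>1 r\<^sub>0 t :: real
  assumes T_measurable: "T \<in> measurable unit_borel unit_borel"
    and mu_prob: "prob_space \<mu>"
    and mu_borel: "sets \<mu> = sets unit_borel"
    and mu_invariant: "distr \<mu> \<mu> T = \<mu>"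
    and mixing: "exponentially_mixing_BV_L1 \<mu> T"
    and y_supp: "y \<in> measure_support \<mu>"
    and c1_pos: "c\<^sub>1 > 0"
    and r0_pos: "r\<^sub>0 > 0"
    and no_short_return:
      "\<And>r k. 0 < r \<Longrightarrow> r < r\<^sub>0 \<Longrightarrow> 1 \<le> k \<Longrightarrow> real k \<le> - c\<^sub>1 * ln r \<Longrightarrow>
         unit_ball y r \<inter> (T ^^ k) ` unit_ball y r = {}"
    and t_nonneg: "t \<ge> 0"
  shows "((\<lambda>r. measure \<mu> {x \<in> space \<mu>.
              ereal_of_enat (hitting_time T (unit_ball y r) x)
                > ereal (t / measure \<mu> (unit_ball y r))}) \<longlongrightarrow> exp (- t)) (at_right 0)"
proof -
  interpret prob_space \<mu> by (rule mu_prob)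
  interpret measure_preserving \<mu> T
    by unfold_locales (use T_measurable mu_invariant measurable_cong_sets[OF mu_borel mu_borel] in auto)
  have space: "space \<mu> = {0..1}"
    using sets_eq_imp_space_eq[OF mu_borel] by (simp add: space_restrict_space)
  have ball_sets [measurable]: "unit_ball y r \<in> sets \<mu>" for r
    unfolding mu_borel unit_ball_def by (auto simp: sets_restrict_space)
  define m where "m = (\<lambda>r. prob (unit_ball y r))"
  define K where "K = (\<lambda>r. nat \<lfloor>- c\<^sub>1 * ln r\<rfloor>)"
  have m_pos: "m r > 0" if "r > 0" for r
  proof -
    have "emeasure \<mu> (ball y r \<inter> space \<mu>) > 0"
      using y_supp that unfolding measure_support_def by auto
    then show ?thesis
      unfolding m_def unit_ball_def space by (simp add: emeasure_eq_measure)
  qed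
  obtain \<theta> C where \<theta>: "\<theta> > 0" and C: "C > 0"
    and mix: "\<And>n f g. integrable \<mu> f \<Longrightarrow> bv_norm g < \<infinity> \<Longrightarrow>
      \<bar>(\<integral>x. f ((T ^^ n) x) * g x \<partial>\<mu>) - (\<integral>x. f x \<partial>\<mu>) * (\<integral>x. g x \<partial>\<mu>)\<bar>
        \<le> C * exp (- \<theta> * real n) * (\<integral>x. \<bar>f x\<bar> \<partial>\<mu>) * enn2real (bv_norm g)"
    using mixing unfolding exponentially_mixing_BV_L1_def by blast
  \<comment> \<open>The ball takes the bounded variation slot. The event \<open>E\<close>, later a
    survival set of uncontrolled variation, takes the other slot, where its norm is just
    \<open>prob E\<close>.\<close>
  have mix_sets: "\<bar>prob (unit_ball y r \<inter> ((T ^^ n) -` E \<inter> space \<mu>)) - prob E * prob (unit_ball y r)\<bar>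
      \<le> 3 * C * exp (- \<theta> * real n) * prob E"
    if "r > 0" and [measurable]: "E \<in> sets \<mu>" for r n E
  proof -
    let ?f = "indicator E :: real \<Rightarrow> real" and ?g = "indicator (unit_ball y r) :: real \<Rightarrow> real"
    have bv: "bv_norm ?g \<le> 3" by (rule bv_norm_indicator_unit_ball) fact
    then have bv_fin: "bv_norm ?g < \<infinity>" by (rule le_less_trans) simp
    have f_int: "integrable \<mu> ?f"
      by (rule integrable_real_indicator) (auto simp: emeasure_eq_measure)
    have "(\<integral>x. ?f ((T ^^ n) x) * ?g x \<partial>\<mu>)
        = (\<integral>x. indicator (unit_ball y r \<inter> ((T ^^ n) -` E \<inter> space \<mu>)) x \<partial>\<mu>)"
      by (intro Bochner_Integration.integral_cong) (auto simp: indicator_def)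
    also have "\<dots> = prob (unit_ball y r \<inter> ((T ^^ n) -` E \<inter> space \<mu>))"
      by (simp add: Int_assoc)
    finally have "\<bar>prob (unit_ball y r \<inter> ((T ^^ n) -` E \<inter> space \<mu>)) - prob E * prob (unit_ball y r)\<bar>
        \<le> C * exp (- \<theta> * real n) * prob E * enn2real (bv_norm ?g)"
      using mix[of ?f ?g n] f_int bv_fin sets.sets_into_space[OF ball_sets] sets.sets_into_space[OF that(2)]
      by (simp add: Int_absorb2)
    also have "\<dots> \<le> C * exp (- \<theta> * real n) * prob E * 3"
      using C enn2real_mono[OF bv] by (intro mult_left_mono) auto
    finally show ?thesis by (simp add: mult_ac)
  qed
  \<comment> \<open>A point of the ball whose \<open>k\<close>-th iterate is again in the ball would
    put that iterate into the intersection of the ball with its image.\<close>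
  have no_return: "unit_ball y r \<inter> (T ^^ k) -` unit_ball y r = {}"
    if "0 < r" "r < r\<^sub>0" "1 \<le> k" "k \<le> K r" for r k
  proof -
    have "real k \<le> - c\<^sub>1 * ln r" using that(3,4) unfolding K_def by linarith
    then show ?thesis using no_short_return[of r k] that by auto
  qed
  have small: "\<forall>\<^sub>F r in at_right 0. 0 < r \<and> r < min r\<^sub>0 1"
    using eventually_at_right_real[of 0 "min r\<^sub>0 1"] r0_pos by (simp add: eventually_mono)
  \<comment> \<open>Rounding down loses less than 1, which \<open>Suc\<close> makes up for. The
    estimate serves both the limit of \<open>m\<close> and the decay of the second error
    term.\<close>
  have K_ge: "real (Suc (K r)) \<ge> - c\<^sub>1 * ln r" for r
    unfolding K_def by linarith

  have m_lim: "(m \<longlongrightarrow> 0) (at_right 0)"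
  proof (rule tendsto_sandwich[of "\<lambda>_. 0" _ _ "\<lambda>r. 1 / (- c\<^sub>1 * ln r)"])
    show "\<forall>\<^sub>F r in at_right 0. m r \<le> 1 / (- c\<^sub>1 * ln r)"
      using small
    proof eventually_elim
      case (elim r)
      then have "- c\<^sub>1 * ln r > 0" using c1_pos by (simp add: mult_pos_neg)
      moreover have "m r * (- c\<^sub>1 * ln r) \<le> m r * real (Suc (K r))"
        using m_pos[of r] elim by (intro mult_left_mono K_ge less_imp_le) blast
      moreover have "real (Suc (K r)) * m r \<le> 1"
        unfolding m_def using elim no_return by (intro prob_le_of_no_return) auto
      ultimately show ?case by (simp only: pos_le_divide_eq mult.commute[of _ "m r"])
    qed
    show "((\<lambda>r. 1 / (- c\<^sub>1 * ln r)) \<longlongrightarrow> 0) (at_right 0)"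
      using c1_pos by real_asymp
  qed (auto simp: m_def)
  \<comment> \<open>Approach through positive values, guaranteed by the support condition, is needed
    to compose with limits involving \<open>ln\<close> and division by \<open>m\<close>.\<close>
  then have m_right: "filterlim m (at_right 0) (at_right 0)"
    using m_pos by (intro filterlim_at_withinI) (auto simp: eventually_at_filter)

  text \<open>The gap is chosen such that \<open>exp (- \<theta> * p r) \<le> (m r)\<^sup>2\<close>.\<close>
  define p where "p = (\<lambda>r. nat \<lceil>- (2 / \<theta>) * ln (m r)\<rceil>)"
  \<comment> \<open>Bounds the error for the gap \<open>p r\<close>; each added 1 absorbs a
    rounding. The gap is long enough for mixing to beat the division by \<open>m r\<close>, yet only
    logarithmic, so that \<open>p r * m r\<close> still vanishes.\<close>
  define \<delta> where "\<delta> = (\<lambda>r. 2 * (1 - (2 / \<theta>) * ln (m r)) * m r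
    + 3 * C * exp (\<theta> * (1 + c\<^sub>1 * ln r)) / (1 - exp (- \<theta>)) + 3 * C * m r)"
  have approx: "\<forall>\<^sub>F r in at_right 0. \<forall>n. \<bar>prob (survival (unit_ball y r) n) - (1 - m r) ^ n\<bar> \<le> \<delta> r"
    using small
  proof (rule eventually_mono, intro allI)
    fix r n assume elim: "0 < r \<and> r < min r\<^sub>0 1"
    have m: "0 < m r" "m r \<le> 1" using m_pos elim by (auto simp: m_def)
    then have ln_m: "- (2 / \<theta>) * ln (m r) \<ge> 0" using \<theta> by (simp add: divide_nonpos_pos)
    have "\<bar>prob (survival (unit_ball y r) n) - (1 - m r) ^ n\<bar>
      \<le> 2 * real (p r) * m r + 3 * C * exp (- \<theta> * real (K r)) / (1 - exp (- \<theta>))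
        + 3 * C * exp (- \<theta> * real (p r)) / m r"
      unfolding m_def using elim C \<theta> m mix_sets no_return
      by (intro prob_survival_approx) (auto simp: m_def)
    also have "\<dots> \<le> \<delta> r"
      unfolding \<delta>_def
    proof (intro add_mono)
      have "real (p r) \<le> 1 - (2 / \<theta>) * ln (m r)" using ln_m unfolding p_def by linarith
      then show "2 * real (p r) * m r \<le> 2 * (1 - (2 / \<theta>) * ln (m r)) * m r"
        using m by (intro mult_right_mono) auto
      have "- real (K r) \<le> 1 + c\<^sub>1 * ln r" using K_ge[of r] by simp
      then have "\<theta> * - real (K r) \<le> \<theta> * (1 + c\<^sub>1 * ln r)" using \<theta> by (intro mult_left_mono) auto
      then show "3 * C * exp (- \<theta> * real (K r)) / (1 - exp (- \<theta>))
          \<le> 3 * C * exp (\<theta> * (1 + c\<^sub>1 * ln r)) / (1 - exp (- \<theta>))"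
        using C \<theta> by (intro divide_right_mono mult_left_mono) auto
      have "- (2 / \<theta>) * ln (m r) \<le> real (p r)" unfolding p_def by linarith
      then have "\<theta> * (- (2 / \<theta>) * ln (m r)) \<le> \<theta> * real (p r)" using \<theta> by (intro mult_left_mono) auto
      then have "- \<theta> * real (p r) \<le> 2 * ln (m r)" using \<theta> by simp
      then have "exp (- \<theta> * real (p r)) \<le> exp (ln (m r) + ln (m r))" by simp
      also have "\<dots> = m r * m r" using m by (simp only: exp_add exp_ln)
      finally have "3 * C * exp (- \<theta> * real (p r)) / m r \<le> 3 * C * (m r * m r) / m r"
        using C m by (intro divide_right_mono mult_left_mono) auto
      then show "3 * C * exp (- \<theta> * real (p r)) / m r \<le> 3 * C * m r" using m by simp
    qed
    finally show "\<bar>prob (survival (unit_ball y r) n) - (1 - m r) ^ n\<bar> \<le> \<delta> r" .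
  qed
  have \<delta>_lim: "(\<delta> \<longlongrightarrow> 0) (at_right 0)"
  proof -
    have "((\<lambda>x. 2 * (1 - (2 / \<theta>) * ln x) * x) \<longlongrightarrow> 0) (at_right 0)"
      using \<theta> by real_asymp
    then have 1: "((\<lambda>r. 2 * (1 - (2 / \<theta>) * ln (m r)) * m r) \<longlongrightarrow> 0) (at_right 0)"
      by (rule filterlim_compose) (rule m_right)
    \<comment> \<open>The exponential equals a constant times the positive power
      \<open>\<theta> * c\<^sub>1\<close> of \<open>r\<close>.\<close>
    have "((\<lambda>r. exp (\<theta> * (1 + c\<^sub>1 * ln r))) \<longlongrightarrow> 0) (at_right 0)"
      using \<theta> c1_pos by real_asymp
    then have 2: "((\<lambda>r. 3 * C * exp (\<theta> * (1 + c\<^sub>1 * ln r)) / (1 - exp (- \<theta>))) \<longlongrightarrow> 3 * C * 0 / (1 - exp (- \<theta>))) (at_right 0)"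
      using \<theta> by (intro tendsto_intros) auto
    show ?thesis
      unfolding \<delta>_def using tendsto_add[OF tendsto_add[OF 1 2] tendsto_mult_left[OF m_lim, of "3 * C"]] by simp
  qed
  \<comment> \<open>Uniformity in \<open>n\<close> of \<open>approx\<close> permits a time that
    varies with \<open>r\<close>.\<close>
  have "((\<lambda>r. prob (survival (unit_ball y r) (nat \<lfloor>t / m r\<rfloor>)) - (1 - m r) ^ nat \<lfloor>t / m r\<rfloor>) \<longlongrightarrow> 0) (at_right 0)"
    using approx by (intro Lim_null_comparison[OF _ \<delta>_lim]) (auto elim: eventually_mono)
  from tendsto_add[OF this filterlim_compose[OF power_floor_tendsto_exp[OF t_nonneg] m_right]]
  have "((\<lambda>r. prob (survival (unit_ball y r) (nat \<lfloor>t / m r\<rfloor>))) \<longlongrightarrow> exp (- t)) (at_right 0)"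
    by simp
  moreover have "{x \<in> space \<mu>. ereal_of_enat (hitting_time T (unit_ball y r) x) > ereal (t / m r)}
      = survival (unit_ball y r) (nat \<lfloor>t / m r\<rfloor>)" for r
    using t_nonneg by (subst hitting_time_gt_iff) (auto simp: m_def survival_set_def)
  ultimately show ?thesis by (simp add: m_def)
qed

end
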